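(* For every positive integer $k$, let $n=2k+1$ and consider the odd cycle $C_{n}$ on vertex set $\mathbb Z_n$ (with $x\sim y$ iff $x-y\equiv\pm1\pmod n$) as a tensegrity graph with no cables (each edge a bar or a strut). Its least eigenvalue framework, which up to a positive scalar is $p_x=\left(\cos\frac{2\pi kx}{n},\ \sin\frac{2\pi kx}{n}\right)^T\in\mathbb R^2$ for $x\in\mathbb Z_n$, is universally completable.
   Context: A tensegrity graph is a graph whose edge set is partitioned into bars $B$, cables $C$ and struts $S$; a tensegrity framework assigns real column vectors $p_v$ to its vertices. For frameworks $G(\mathbf p)$ and $G(\mathbf q)$ (the $q_v$ may lie in a real space of any dimension), $G(\mathbf p)$ dominates $G(\mathbf q)$ if $q_u^Tq_v=p_u^Tp_v$ for $uv\in B$ and for $u=v$, $q_u^Tq_v\ge p_u^Tp_v$ for $uv\in C$, and $q_u^Tq_v\le p_u^Tp_v$ for $uv\in S$; it is universally completable if every framework it dominates has the same Gram matrix. The least eigenvalue framework of a graph with adjacency matrix $A$ is given by the rows of a matrix whose columns form an orthonormal basis of the eigenspace of $A$ for its least eigenvalue. *)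

theory Defs
  imports
    Complex_Main
    "HOL-Number_Theory.Cong"
    "Jordan_Normal_Form.VS_Connect"
    "Jordan_Normal_Form.Char_Poly"
begin

section \<open>Tensegrity graphs and frameworks\<close>

text \<open>The vertex set is \<open>{..<num_verts T}\<close>, so that adjacency and Gram matrices are matrices
  of the matrix library. Edges are two-element vertex sets.\<close>

record tensegrity =
  num_verts :: nat
  bars :: "nat set set"
  cables :: "nat set set"
  struts :: "nat set set"

definition edges :: "tensegrity \<Rightarrow> nat set set" where
  "edges T = bars T \<union> cables T \<union> struts T"

definition tensegrity_graph :: "tensegrity \<Rightarrow> bool" where
  "tensegrity_graph T \<longleftrightarrow>
     edges T \<subseteq> {{u, v} | u v. u < num_verts T \<and> v < num_verts T \<and> u \<noteq> v} \<and>
     bars T \<inter> cables T = {} \<and> bars T \<inter> struts T = {} \<and> cables T \<inter> struts T = {}"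

text \<open>The dimension \<open>d\<close> of the ambient space depends on the framework. Hence the quantifier over
  frameworks in \<open>universally_completable\<close> ranges over all dimensions.\<close>

definition framework :: "tensegrity \<Rightarrow> (nat \<Rightarrow> real vec) \<Rightarrow> bool" where
  "framework T p \<longleftrightarrow> (\<exists>d. \<forall>v < num_verts T. p v \<in> carrier_vec d)"

definition dominates :: "tensegrity \<Rightarrow> (nat \<Rightarrow> real vec) \<Rightarrow> (nat \<Rightarrow> real vec) \<Rightarrow> bool" where
  "dominates T p q \<longleftrightarrow>
     (\<forall>u < num_verts T. q u \<bullet> q u = p u \<bullet> p u) \<and>
     (\<forall>u v. {u, v} \<in> bars T \<longrightarrow> q u \<bullet> q v = p u \<bullet> p v) \<and>
     (\<forall>u v. {u, v} \<in> cables T \<longrightarrow> q u \<bullet> q v \<ge> p u \<bullet> p v) \<and>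
     (\<forall>u v. {u, v} \<in> struts T \<longrightarrow> q u \<bullet> q v \<le> p u \<bullet> p v)"

definition gram_matrix :: "nat \<Rightarrow> (nat \<Rightarrow> real vec) \<Rightarrow> real mat" where
  "gram_matrix n p = mat n n (\<lambda>(u, v). p u \<bullet> p v)"

definition universally_completable :: "tensegrity \<Rightarrow> (nat \<Rightarrow> real vec) \<Rightarrow> bool" where
  "universally_completable T p \<longleftrightarrow>
     framework T p \<and>
     (\<forall>q. framework T q \<longrightarrow> dominates T p q \<longrightarrow>
        gram_matrix (num_verts T) q = gram_matrix (num_verts T) p)"

section \<open>Least eigenvalue frameworks\<close>

definition adjacency_matrix :: "nat \<Rightarrow> nat set set \<Rightarrow> real mat" where
  "adjacency_matrix n E = mat n n (\<lambda>(u, v). if {u, v} \<in> E then 1 else 0)"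

definition least_eigenvalue :: "real mat \<Rightarrow> real \<Rightarrow> bool" where
  "least_eigenvalue A \<tau> \<longleftrightarrow> eigenvalue A \<tau> \<and> (\<forall>\<mu>. eigenvalue A \<mu> \<longrightarrow> \<tau> \<le> \<mu>)"

definition eigenspace :: "real mat \<Rightarrow> real \<Rightarrow> real vec set" where
  "eigenspace A \<tau> = {v \<in> carrier_vec (dim_row A). A *\<^sub>v v = \<tau> \<cdot>\<^sub>v v}"

definition orthonormal_basis_columns :: "nat \<Rightarrow> real mat \<Rightarrow> real vec set \<Rightarrow> bool" where
  "orthonormal_basis_columns n P W \<longleftrightarrow>
     P \<in> carrier_mat n (dim_col P) \<and>
     (\<forall>i < dim_col P. \<forall>j < dim_col P. col P i \<bullet> col P j = (if i = j then 1 else 0)) \<and>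
     LinearCombinations.module.span class_ring (module_vec TYPE(real) n) (set (cols P)) = W"

text \<open>A relation rather than a function, because the framework depends on the choice of the
  orthonormal basis.\<close>

definition least_eigenvalue_framework :: "nat \<Rightarrow> nat set set \<Rightarrow> (nat \<Rightarrow> real vec) \<Rightarrow> bool" where
  "least_eigenvalue_framework n E p \<longleftrightarrow>
     (\<exists>\<tau> P. least_eigenvalue (adjacency_matrix n E) \<tau> \<and>
        orthonormal_basis_columns n P (eigenspace (adjacency_matrix n E) \<tau>) \<and>
        (\<forall>v < n. p v = row P v))"

section \<open>Odd cycles\<close>

definition cycle_edges :: "nat \<Rightarrow> nat set set" where
  "cycle_edges n = {{x, y} | x y. x < n \<and> y < n \<and>
     ([int x - int y = 1] (mod int n) \<or> [int x - int y = - 1] (mod int n))}"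

definition odd_cycle_framework :: "nat \<Rightarrow> nat \<Rightarrow> real vec" where
  "odd_cycle_framework k x = vec_of_list
     [cos (2 * pi * real k * real x / real (2 * k + 1)),
      sin (2 * pi * real k * real x / real (2 * k + 1))]"

end

theory Submission
  imports Defs
begin

text \<open>Put \<open>\<theta> = 2 * pi * k / n\<close>. The quadratic form of \<open>A - 2 * cos \<theta>\<close> is positive semidefinite:
  after subtracting a multiple of the cosine vector, which lies in its radical, one may assume
  that \<open>y 0 = 0\<close>, and then Picone's identity for the solution \<open>sin (x * \<theta>)\<close> of the eigenvalue
  recurrence writes the form as a sum of squares whose weights are positive because this
  solution alternates in sign on \<open>1, \<dots>, n - 1\<close>. The form vanishes only on combinations of the
  cosine and sine vectors, so \<open>2 * cos \<theta>\<close> is the least eigenvalue with these as eigenspace.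
  The Gram matrix of a least eigenvalue framework is the orthogonal projection onto this space
  and does not depend on the basis.\<close>

section \<open>Orthonormal bases and projections\<close>

text \<open>The span of the columns of a matrix is its image. This trades the abstract span for
  matrix-vector products, with which matrix algebra can work.\<close>

lemma orthonormal_basis_columns_iff:
  "orthonormal_basis_columns n P W \<longleftrightarrow>
    P \<in> carrier_mat n (dim_col P) \<and>
    (\<forall>i < dim_col P. \<forall>j < dim_col P. col P i \<bullet> col P j = (if i = j then 1 else 0)) \<and>
    {P *\<^sub>v x | x. x \<in> carrier_vec (dim_col P)} = W"
proof -
  have span: "LinearCombinations.module.span class_ring (module_vec TYPE(real) n) (set (cols P)) =
      {P *\<^sub>v x | x. x \<in> carrier_vec (dim_col P)}"
    if "P \<in> carrier_mat n (dim_col P)"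
  proof -
    have "{y \<in> carrier_vec (dim_row P). \<exists>x \<in> carrier_vec (dim_col P). P *\<^sub>v x = y} =
        {P *\<^sub>v x | x. x \<in> carrier_vec (dim_col P)}"
      by (intro Collect_cong) (metis carrier_vecI dim_mult_mat_vec)
    then show ?thesis
      using vec_space.col_space_eq[OF that] unfolding vec_space.col_space_def by simp
  qed
  show ?thesis
    unfolding orthonormal_basis_columns_def by (intro conj_cong refl) (simp only: span)
qed

text \<open>Orthonormality says \<open>P\<^sup>T * P = 1\<^sub>m m\<close>, so
  \<open>P * P\<^sup>T\<close> fixes every vector of \<open>W\<close>, in particular each column of
  \<open>Q\<close>.\<close>

lemma orthonormal_basis_columns_projection:
  assumes "orthonormal_basis_columns n P W" "orthonormal_basis_columns n Q W"
  shows "(P * P\<^sup>T) * (Q * Q\<^sup>T) = Q * Q\<^sup>T"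
proof -
  define m l where "m = dim_col P" and "l = dim_col Q"
  have P: "P \<in> carrier_mat n m" and Q: "Q \<in> carrier_mat n l"
    and W: "{P *\<^sub>v x | x. x \<in> carrier_vec m} = {Q *\<^sub>v x | x. x \<in> carrier_vec l}"
    and orth: "\<forall>i < m. \<forall>j < m. col P i \<bullet> col P j = (if i = j then 1 else 0)"
    using assms unfolding orthonormal_basis_columns_iff m_def[symmetric] l_def[symmetric]
    by simp_all
  have PtP: "P\<^sup>T * P = 1\<^sub>m m"
    using P orth by (intro eq_matI) simp_all
  have fixed: "(P * P\<^sup>T) *\<^sub>v w = w" if w: "w \<in> {P *\<^sub>v x | x. x \<in> carrier_vec m}" for w
  proof -
    obtain x where x: "x \<in> carrier_vec m" "w = P *\<^sub>v x"
      using w unfolding mem_Collect_eq by metis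
    have "(P * P\<^sup>T) *\<^sub>v w = P *\<^sub>v (P\<^sup>T *\<^sub>v (P *\<^sub>v x))"
      unfolding x(2) using P x(1) by (subst assoc_mult_mat_vec[of P n m "P\<^sup>T" n]) simp_all
    also have "P\<^sup>T *\<^sub>v (P *\<^sub>v x) = (P\<^sup>T * P) *\<^sub>v x"
      using P x(1) by (subst assoc_mult_mat_vec[of "P\<^sup>T" m n]) simp_all
    finally show ?thesis
      using x PtP by simp
  qed
  have "(P * P\<^sup>T) * Q = Q"
  proof (rule mat_col_eqI)
    fix i assume i: "i < dim_col Q"
    then have "col Q i = Q *\<^sub>v unit_vec l i"
      using Q by (intro eq_vecI) simp_all
    then have "col Q i \<in> {P *\<^sub>v x | x. x \<in> carrier_vec m}"
      unfolding W mem_Collect_eq by (metis unit_vec_carrier)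
    then show "col ((P * P\<^sup>T) * Q) i = col Q i"
      using P Q i by (subst col_mult2[of _ n n _ l]) (simp_all only: fixed, simp_all)
  qed (use P Q in simp_all)
  moreover have "(P * P\<^sup>T) * (Q * Q\<^sup>T) = ((P * P\<^sup>T) * Q) * Q\<^sup>T"
    using P Q by (subst assoc_mult_mat[of "P * P\<^sup>T" n n Q l]) simp_all
  ultimately show ?thesis
    by simp
qed

text \<open>Both products are symmetric and each absorbs the other from the right, so transposing
  one absorption identity and applying the other one identifies them.\<close>

lemma orthonormal_basis_columns_unique_projection:
  assumes "orthonormal_basis_columns n P W" "orthonormal_basis_columns n Q W"
  shows "P * P\<^sup>T = Q * Q\<^sup>T"
proof -
  obtain m l where P: "P \<in> carrier_mat n m" and Q: "Q \<in> carrier_mat n l"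
    using assms unfolding orthonormal_basis_columns_def by metis
  have symm: "(M * M\<^sup>T)\<^sup>T = M * M\<^sup>T" if "M \<in> carrier_mat n m" for M :: "real mat" and m
    using that by (subst transpose_mult[of M n m]) simp_all
  have "P * P\<^sup>T = ((Q * Q\<^sup>T) * (P * P\<^sup>T))\<^sup>T"
    by (simp only: orthonormal_basis_columns_projection[OF assms(2,1)] symm[OF P])
  also have "\<dots> = (P * P\<^sup>T)\<^sup>T * (Q * Q\<^sup>T)\<^sup>T"
    using P Q by (subst transpose_mult[of "Q * Q\<^sup>T" n n _ n]) simp_all
  also have "\<dots> = Q * Q\<^sup>T"
    unfolding symm[OF P] symm[OF Q] by (rule orthonormal_basis_columns_projection[OF assms])
  finally show ?thesis .
qed

section \<open>The quadratic form of the odd cycle\<close>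

lemma odd_cycle_framework_carrier: "odd_cycle_framework k x \<in> carrier_vec 2"
proof -
  have "vec_of_list [a, b] \<in> carrier_vec 2" for a b :: real
    by (rule carrier_vecI) simp
  then show ?thesis
    unfolding odd_cycle_framework_def .
qed

locale odd_cycle =
  fixes k n :: nat
  assumes k_pos: "k \<ge> 1" and n_def: "n = 2 * k + 1"
begin

definition \<theta> :: real where
  "\<theta> = 2 * pi * real k / real n"

text \<open>For \<open>y n = y 0\<close> this is the quadratic form of the adjacency matrix minus
  \<open>2 * cos \<theta>\<close>. Working with sequences up to index \<open>n\<close> instead of
  residues lets sums telescope.\<close>

definition cycle_form :: "(nat \<Rightarrow> real) \<Rightarrow> real" where
  "cycle_form y = (\<Sum>x<n. 2 * y x * y (Suc x) - 2 * cos \<theta> * (y x)\<^sup>2)"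

lemma n_ge_3: "n \<ge> 3"
  using k_pos n_def by simp

lemma n_times_theta: "real n * \<theta> = 2 * pi * real k"
  using n_ge_3 by (simp add: \<theta>_def)

lemma cos_n_theta: "cos (real n * \<theta>) = 1" and sin_n_theta: "sin (real n * \<theta>) = 0"
proof -
  have "real n * \<theta> = 2 * real k * pi"
    by (simp add: n_times_theta)
  then show "cos (real n * \<theta>) = 1" "sin (real n * \<theta>) = 0"
    using cos_npi[of "2 * k"] sin_npi[of "2 * k"] by simp_all
qed

text \<open>Since \<open>n = 2 * k + 1\<close>, the angle \<open>\<theta>\<close> equals
  \<open>pi - pi / n\<close>. This exhibits the alternating sign, as the remaining sine is positive
  for \<open>1 \<le> x < n\<close>.\<close>

lemma sin_multiple_theta: "sin (real x * \<theta>) = - ((- 1) ^ x * sin (real x * (pi / real n)))"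
proof -
  have "\<theta> = pi - pi / real n"
    unfolding \<theta>_def by (simp add: n_def field_simps)
  then have "real x * \<theta> = real x * pi - real x * (pi / real n)"
    by (simp only: right_diff_distrib)
  then show ?thesis
    by (simp add: sin_diff)
qed

lemma sin_fraction_pos:
  assumes "1 \<le> x" "x < n"
  shows "sin (real x * (pi / real n)) > 0"
proof (rule sin_gt_zero)
  show "0 < real x * (pi / real n)"
    using assms by simp
  show "real x * (pi / real n) < pi"
    using assms by (simp add: field_simps)
qed

lemma sin_multiple_theta_nonzero:
  assumes "1 \<le> x" "x < n"
  shows "sin (real x * \<theta>) \<noteq> 0"
  using sin_fraction_pos[OF assms] by (simp add: sin_multiple_theta)

lemma sin_theta_nonzero: "sin \<theta> \<noteq> 0"
  using sin_multiple_theta_nonzero[of 1] n_ge_3 by simp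

text \<open>Consecutive sines have opposite signs; this is what makes the weights in Picone's
  identity positive.\<close>

lemma sin_ratio_neg:
  assumes "1 \<le> x" "Suc x < n"
  shows "sin (real (Suc x) * \<theta>) / sin (real x * \<theta>) < 0"
proof -
  have "sin (real x * (pi / real n)) > 0" "sin (real (Suc x) * (pi / real n)) > 0"
    by (rule sin_fraction_pos; use assms in simp)+
  then have "sin (real (Suc x) * (pi / real n)) / sin (real x * (pi / real n)) > 0"
    by simp
  moreover have "sin (real (Suc x) * \<theta>) / sin (real x * \<theta>) =
      - (sin (real (Suc x) * (pi / real n)) / sin (real x * (pi / real n)))"
    unfolding sin_multiple_theta by (simp add: field_simps)
  ultimately show ?thesis
    by simp
qed

lemma sin_recurrence:
  "sin (real (Suc (Suc x)) * \<theta>) = 2 * cos \<theta> * sin (real (Suc x) * \<theta>) - sin (real x * \<theta>)"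
proof -
  define \<phi> where "\<phi> = real (Suc x) * \<theta>"
  have "real (Suc (Suc x)) * \<theta> = \<phi> + \<theta>" "real x * \<theta> = \<phi> - \<theta>"
    by (simp_all add: \<phi>_def algebra_simps)
  then have "sin (real (Suc (Suc x)) * \<theta>) = sin \<phi> * cos \<theta> + cos \<phi> * sin \<theta>"
    "sin (real x * \<theta>) = sin \<phi> * cos \<theta> - cos \<phi> * sin \<theta>"
    by (simp_all only: sin_add sin_diff)
  then show ?thesis
    unfolding \<phi>_def[symmetric] by (simp only:) (simp add: algebra_simps)
qed

text \<open>Picone's identity: the zeros of \<open>sin (x * \<theta>)\<close> at \<open>0\<close> and \<open>n\<close> absorb the boundary terms.\<close>

lemma picone_partial_sum:
  assumes "y 0 = 0" "Suc m < n"
  shows "(\<Sum>x<Suc m. 2 * y x * y (Suc x) - 2 * cos \<theta> * (y x)\<^sup>2) =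
    (\<Sum>x = 1..<Suc m. - (sin (real (Suc x) * \<theta>) / sin (real x * \<theta>)) *
        (y x - sin (real x * \<theta>) / sin (real (Suc x) * \<theta>) * y (Suc x))\<^sup>2) +
    sin (real m * \<theta>) / sin (real (Suc m) * \<theta>) * (y (Suc m))\<^sup>2"
  using assms(2)
proof (induction m)
  case 0
  then show ?case
    using assms(1) by simp
next
  case (Suc m)
  define a where "a = sin (real m * \<theta>)"
  define b where "b = sin (real (Suc m) * \<theta>)"
  define c where "c = sin (real (Suc (Suc m)) * \<theta>)"
  have nz: "b \<noteq> 0" "c \<noteq> 0"
    unfolding b_def c_def by (rule sin_multiple_theta_nonzero; use Suc.prems in simp)+
  have "c = 2 * cos \<theta> * b - a"
    unfolding a_def b_def c_def by (rule sin_recurrence)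
  then have a: "a = 2 * cos \<theta> * b - c"
    by simp
  have "a / b * (y (Suc m))\<^sup>2 + (2 * y (Suc m) * y (Suc (Suc m)) - 2 * cos \<theta> * (y (Suc m))\<^sup>2) =
     - (c / b) * (y (Suc m) - b / c * y (Suc (Suc m)))\<^sup>2 + b / c * (y (Suc (Suc m)))\<^sup>2"
  proof -
    \<comment> \<open>With these ratios the recurrence reads
      \<open>a / b = 2 * cos \<theta> - p\<close>. The \<open>cos \<theta>\<close> terms cancel, and
      \<open>p * q = 1\<close> turns the rest into a completed square.\<close>
    define p q where "p = c / b" and "q = b / c"
    have "a / b = 2 * cos \<theta> - p" "p * q = 1"
      using nz by (simp_all add: a p_def q_def diff_divide_distrib)
    have "p * (y (Suc m) - q * z)\<^sup>2 =
        p * (y (Suc m))\<^sup>2 - 2 * (p * q) * y (Suc m) * z + (p * q) * q * z\<^sup>2" for z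
      by (simp add: power2_eq_square algebra_simps)
    then show ?thesis
      unfolding \<open>a / b = _\<close> p_def[symmetric] q_def[symmetric] \<open>p * q = 1\<close>
      by (simp only: left_diff_distrib mult_minus_left)
  qed
  moreover note Suc.IH[OF Suc_lessD[OF Suc.prems]]
  ultimately show ?case
    unfolding a_def b_def c_def by simp
qed

lemma picone_identity:
  assumes "y 0 = 0" "y n = 0"
  shows "cycle_form y =
    (\<Sum>x = 1..<n - 1. - (sin (real (Suc x) * \<theta>) / sin (real x * \<theta>)) *
        (y x - sin (real x * \<theta>) / sin (real (Suc x) * \<theta>) * y (Suc x))\<^sup>2)"
proof -
  define m where "m = n - 2"
  have m: "Suc (Suc m) = n"
    using n_ge_3 by (simp add: m_def)
  have split: "(\<Sum>x<n. f x) = (\<Sum>x<Suc m. f x) + f (Suc m)" for f :: "nat \<Rightarrow> real"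
    using sum.lessThan_Suc[of f "Suc m"] unfolding m .
  \<comment> \<open>The next ratio would have \<open>sin (n * \<theta>) = 0\<close> as denominator,
    so the partial sum stops one term early. The recurrence at \<open>n\<close> gives its boundary
    term the coefficient \<open>2 * cos \<theta>\<close>, which cancels the last summand because
    \<open>y n = 0\<close>.\<close>
  have "2 * cos \<theta> * sin (real (Suc m) * \<theta>) = sin (real m * \<theta>)"
    using sin_recurrence[of m] unfolding m sin_n_theta by (metis eq_iff_diff_eq_0)
  moreover have "sin (real (Suc m) * \<theta>) \<noteq> 0"
    by (rule sin_multiple_theta_nonzero) (use m in simp_all)
  ultimately have "sin (real m * \<theta>) / sin (real (Suc m) * \<theta>) = 2 * cos \<theta>"
    by (metis nonzero_mult_div_cancel_right)
  moreover have "Suc m < n" "n - 1 = Suc m"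
    using m by simp_all
  ultimately show ?thesis
    using picone_partial_sum[of y m] assms unfolding cycle_form_def split m by simp
qed

lemma cycle_form_nonneg_of_zero:
  assumes "y 0 = 0" "y n = 0"
  shows "cycle_form y \<ge> 0"
  unfolding picone_identity[OF assms]
proof (rule sum_nonneg)
  fix x assume "x \<in> {1..<n - 1}"
  then have "sin (real (Suc x) * \<theta>) / sin (real x * \<theta>) < 0"
    by (intro sin_ratio_neg) auto
  then show "0 \<le> - (sin (real (Suc x) * \<theta>) / sin (real x * \<theta>)) *
        (y x - sin (real x * \<theta>) / sin (real (Suc x) * \<theta>) * y (Suc x))\<^sup>2"
    by (intro mult_nonneg_nonneg) auto
qed

text \<open>All weights in Picone's identity are strictly positive, so every square vanishes. Hence
  \<open>y x / sin (x * \<theta>)\<close> is constant for \<open>1 \<le> x < n\<close>, with its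
  value read off at \<open>x = 1\<close>.\<close>

lemma cycle_form_eq_0_of_zero:
  assumes "y 0 = 0" "y n = 0" "cycle_form y = 0" "x < n"
  shows "y x = y 1 / sin \<theta> * sin (real x * \<theta>)"
proof -
  have neg: "sin (real (Suc z) * \<theta>) / sin (real z * \<theta>) < 0" if "z \<in> {1..<n - 1}" for z
    using that by (intro sin_ratio_neg) auto
  have "\<forall>z \<in> {1..<n - 1}. - (sin (real (Suc z) * \<theta>) / sin (real z * \<theta>)) *
        (y z - sin (real z * \<theta>) / sin (real (Suc z) * \<theta>) * y (Suc z))\<^sup>2 = 0"
  proof (subst sum_nonneg_eq_0_iff[symmetric])
    show "0 \<le> - (sin (real (Suc z) * \<theta>) / sin (real z * \<theta>)) *
        (y z - sin (real z * \<theta>) / sin (real (Suc z) * \<theta>) * y (Suc z))\<^sup>2" if "z \<in> {1..<n - 1}" for z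
      using neg[OF that] by (intro mult_nonneg_nonneg) auto
  qed (use picone_identity[OF assms(1,2)] assms(3) in simp_all)
  then have step: "y z = sin (real z * \<theta>) / sin (real (Suc z) * \<theta>) * y (Suc z)"
    if "z \<in> {1..<n - 1}" for z
    using neg[OF that] that by fastforce
  show ?thesis
    using \<open>x < n\<close>
  proof (induction x)
    case 0
    then show ?case
      using assms(1) by simp
  next
    case (Suc x)
    show ?case
    proof (cases "x = 0")
      case True
      then show ?thesis
        using sin_theta_nonzero by simp
    next
      case False
      have "sin (real x * \<theta>) \<noteq> 0" "sin (real (Suc x) * \<theta>) \<noteq> 0"
        by (rule sin_multiple_theta_nonzero; use False Suc.prems in simp)+
      moreover have "y x = sin (real x * \<theta>) / sin (real (Suc x) * \<theta>) * y (Suc x)"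
        using step False Suc.prems by simp
      moreover have "y x = y 1 / sin \<theta> * sin (real x * \<theta>)"
        using Suc by simp
      ultimately show ?thesis
        using sin_theta_nonzero by (simp add: field_simps)
    qed
  qed
qed

text \<open>Since the cosine vector lies in the radical of the form, it can be used to normalize \<open>y 0\<close>
  to \<open>0\<close>.\<close>

lemma cycle_form_minus_cos:
  assumes "y n = y 0"
  shows "cycle_form (\<lambda>x. y x - a * cos (real x * \<theta>)) = cycle_form y"
proof -
  define u where "u x = cos (real x * \<theta>)" for x
  \<comment> \<open>The cosine is the value of \<open>u\<close> one place before \<open>x\<close>,
    written so that it also makes sense at \<open>x = 0\<close>. By the recurrence for
    \<open>u\<close>, the polar form with \<open>u\<close> telescopes along
    \<open>g\<close>.\<close>
  define g where "g z x = cos (real x * \<theta> - \<theta>) * z x" for z :: "nat \<Rightarrow> real" and x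
  have polar: "(\<Sum>x<n. u x * z (Suc x) + u (Suc x) * z x - 2 * cos \<theta> * u x * z x) = 0"
    if "z n = z 0" for z
  proof -
    have "u x * z (Suc x) + u (Suc x) * z x - 2 * cos \<theta> * u x * z x = g z (Suc x) - g z x" for x
    proof -
      have "u (Suc x) = cos (real x * \<theta> + \<theta>)" "g z (Suc x) = u x * z (Suc x)"
        by (simp_all add: u_def g_def algebra_simps)
      then show ?thesis
        by (simp add: u_def g_def cos_add cos_diff algebra_simps)
    qed
    then have "(\<Sum>x<n. u x * z (Suc x) + u (Suc x) * z x - 2 * cos \<theta> * u x * z x) = g z n - g z 0"
      by (simp add: sum_lessThan_telescope)
    also have "\<dots> = 0"
      using that by (simp add: g_def cos_diff cos_n_theta sin_n_theta)
    finally show ?thesis .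
  qed
  have "u n = u 0"
    by (simp add: u_def cos_n_theta)
  \<comment> \<open>Expansion of the quadratic form at a difference: the mixed term and the
    \<open>u\<close> term are both polar forms with \<open>u\<close> in one slot, so
    \<open>polar\<close> removes them.\<close>
  have "cycle_form (\<lambda>x. y x - a * u x) =
      (\<Sum>x<n. (2 * y x * y (Suc x) - 2 * cos \<theta> * (y x)\<^sup>2)
        - 2 * a * (u x * y (Suc x) + u (Suc x) * y x - 2 * cos \<theta> * u x * y x)
        + a\<^sup>2 * (u x * u (Suc x) + u (Suc x) * u x - 2 * cos \<theta> * u x * u x))"
    unfolding cycle_form_def by (rule sum.cong) (simp_all add: algebra_simps power2_eq_square)
  also have "\<dots> = cycle_form y"
    unfolding cycle_form_def
    by (simp only: sum.distrib[of "\<lambda>x. A x - B x" for A B] sum_subtractf[of _ "\<lambda>x. 2 * a * B x" for B]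
        sum_distrib_left[symmetric] polar[OF assms] polar[OF \<open>u n = u 0\<close>] mult_zero_right
        add_0_right diff_0_right)
  finally show ?thesis
    unfolding u_def .
qed

lemma cycle_form_nonneg:
  assumes "y n = y 0"
  shows "cycle_form y \<ge> 0"
  using cycle_form_nonneg_of_zero[of "\<lambda>x. y x - y 0 * cos (real x * \<theta>)"]
    cycle_form_minus_cos[OF assms] assms cos_n_theta by simp

lemma cycle_form_eq_0:
  assumes "y n = y 0" "cycle_form y = 0"
  shows "\<exists>a b. \<forall>x < n. y x = a * cos (real x * \<theta>) + b * sin (real x * \<theta>)"
proof -
  define v where "v x = y x - y 0 * cos (real x * \<theta>)" for x
  have "v 0 = 0" "v n = 0" "cycle_form v = 0"
    using cycle_form_minus_cos[OF assms(1)] assms cos_n_theta by (simp_all add: v_def[abs_def])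
  from cycle_form_eq_0_of_zero[OF this]
  have "\<forall>x < n. y x = y 0 * cos (real x * \<theta>) + v 1 / sin \<theta> * sin (real x * \<theta>)"
    by (force simp: v_def)
  then show ?thesis
    by blast
qed

section \<open>Orthogonality relations for the cosine and sine vectors\<close>

text \<open>Multiplication by the nonzero number \<open>2 * sin \<theta>\<close> makes the sum
  telescope, and the end values agree because \<open>n * \<theta>\<close> is a multiple of
  \<open>2 * pi\<close>.\<close>

lemma sum_cos_double: "(\<Sum>x<n. cos (2 * (real x * \<theta>))) = 0"
proof -
  define f where "f x = sin (2 * (real x * \<theta>) - \<theta>)" for x
  have "2 * sin \<theta> * (\<Sum>x<n. cos (2 * (real x * \<theta>))) = (\<Sum>x<n. f (Suc x) - f x)"
    unfolding sum_distrib_left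
  proof (rule sum.cong)
    fix x
    have "f (Suc x) = sin (2 * (real x * \<theta>) + \<theta>)"
      by (simp add: f_def algebra_simps)
    then show "2 * sin \<theta> * cos (2 * (real x * \<theta>)) = f (Suc x) - f x"
      by (simp add: f_def sin_add sin_diff)
  qed simp
  also have "\<dots> = f n - f 0"
    by (rule sum_lessThan_telescope)
  also have "\<dots> = 0"
    by (simp add: f_def sin_diff sin_double cos_double cos_n_theta sin_n_theta)
  finally show ?thesis
    using sin_theta_nonzero by simp
qed

lemma sum_sin_double: "(\<Sum>x<n. sin (2 * (real x * \<theta>))) = 0"
proof -
  define f where "f x = - cos (2 * (real x * \<theta>) - \<theta>)" for x
  have "2 * sin \<theta> * (\<Sum>x<n. sin (2 * (real x * \<theta>))) = (\<Sum>x<n. f (Suc x) - f x)"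
    unfolding sum_distrib_left
  proof (rule sum.cong)
    fix x
    have "f (Suc x) = - cos (2 * (real x * \<theta>) + \<theta>)"
      by (simp add: f_def algebra_simps)
    then show "2 * sin \<theta> * sin (2 * (real x * \<theta>)) = f (Suc x) - f x"
      by (simp add: f_def cos_add cos_diff)
  qed simp
  also have "\<dots> = f n - f 0"
    by (rule sum_lessThan_telescope)
  also have "\<dots> = 0"
    by (simp add: f_def cos_diff sin_double cos_double cos_n_theta sin_n_theta)
  finally show ?thesis
    using sin_theta_nonzero by simp
qed

lemma sum_cos_squared: "(\<Sum>x<n. cos (real x * \<theta>) * cos (real x * \<theta>)) = real n / 2"
proof -
  have "cos (real x * \<theta>) * cos (real x * \<theta>) = 1 / 2 + cos (2 * (real x * \<theta>)) / 2" for x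
    using cos_double_cos[of "real x * \<theta>"] by (simp add: power2_eq_square field_simps)
  then show ?thesis
    by (simp add: sum.distrib sum_divide_distrib[symmetric] sum_cos_double)
qed

lemma sum_sin_squared: "(\<Sum>x<n. sin (real x * \<theta>) * sin (real x * \<theta>)) = real n / 2"
proof -
  have "sin (real x * \<theta>) * sin (real x * \<theta>) = 1 / 2 - cos (2 * (real x * \<theta>)) / 2" for x
    using cos_double_sin[of "real x * \<theta>"] by (simp add: power2_eq_square field_simps)
  then show ?thesis
    by (simp add: sum_subtractf sum_divide_distrib[symmetric] sum_cos_double)
qed

lemma sum_cos_sin: "(\<Sum>x<n. cos (real x * \<theta>) * sin (real x * \<theta>)) = 0"
proof -
  have "cos (real x * \<theta>) * sin (real x * \<theta>) = sin (2 * (real x * \<theta>)) / 2" for x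
    using sin_double[of "real x * \<theta>"] by simp
  then show ?thesis
    by (simp only: sum_divide_distrib[symmetric] sum_sin_double)
qed

section \<open>Periodicity and sums over neighbours in the cycle\<close>

lemma cos_mod: "cos (real (m mod n) * \<theta>) = cos (real m * \<theta>)"
  and sin_mod: "sin (real (m mod n) * \<theta>) = sin (real m * \<theta>)"
proof -
  have shift: "cos (real (r + q * n) * \<theta>) = cos (real r * \<theta>) \<and>
      sin (real (r + q * n) * \<theta>) = sin (real r * \<theta>)" for r q
  proof (induction q)
    case (Suc q)
    have "real (r + Suc q * n) * \<theta> = real (r + q * n) * \<theta> + real n * \<theta>"
      by (simp add: algebra_simps)
    then show ?case
      using Suc by (simp only: cos_add sin_add cos_n_theta sin_n_theta) simp
  qed simp
  show "cos (real (m mod n) * \<theta>) = cos (real m * \<theta>)" "sin (real (m mod n) * \<theta>) = sin (real m * \<theta>)"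
    using shift[of "m mod n" "m div n"] by simp_all
qed

lemma cycle_edge_iff:
  assumes "x < n" "y < n"
  shows "{x, y} \<in> cycle_edges n \<longleftrightarrow> y = Suc x mod n \<or> x = Suc y mod n"
proof -
  have step: "[int a - int b = 1] (mod int n) \<longleftrightarrow> a = Suc b mod n" if "a < n" "b < n" for a b
  proof -
    have "[int a - int b = 1] (mod int n) \<longleftrightarrow> [int a = int (Suc b)] (mod int n)"
      by (simp add: cong_iff_dvd_diff algebra_simps)
    also have "\<dots> \<longleftrightarrow> [a = Suc b] (mod n)"
      by (rule cong_int_iff)
    finally show ?thesis
      using that by (simp add: cong_def)
  qed
  have neg: "[int a - int b = - 1] (mod int n) \<longleftrightarrow> [int b - int a = 1] (mod int n)" for a b
    using cong_minus_minus_iff[of "int b - int a" 1 "int n"] by simp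
  have "{x, y} \<in> cycle_edges n \<longleftrightarrow>
      [int x - int y = 1] (mod int n) \<or> [int y - int x = 1] (mod int n)"
  proof
    assume "{x, y} \<in> cycle_edges n"
    then show "[int x - int y = 1] (mod int n) \<or> [int y - int x = 1] (mod int n)"
      unfolding cycle_edges_def neg by (auto simp: doubleton_eq_iff)
  next
    assume "[int x - int y = 1] (mod int n) \<or> [int y - int x = 1] (mod int n)"
    then show "{x, y} \<in> cycle_edges n"
      unfolding cycle_edges_def neg using assms by blast
  qed
  then show ?thesis
    using step assms by blast
qed

text \<open>As \<open>n \<ge> 3\<close>, successor and predecessor differ and no neighbour is
  counted twice. The predecessor term stays a sum so that a later exchange of summations can turn it
  into a successor term.\<close>

lemma sum_cycle_neighbours:
  fixes f :: "nat \<Rightarrow> real"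
  assumes "x < n"
  shows "(\<Sum>y<n. (if {x, y} \<in> cycle_edges n then 1 else 0) * f y) =
    f (Suc x mod n) + (\<Sum>y<n. if x = Suc y mod n then f y else 0)"
proof -
  have disjoint: "\<not> (y = Suc x mod n \<and> x = Suc y mod n)" if "y < n" for y
    using assms that n_ge_3 by (auto simp: mod_Suc split: if_splits)
  have "(\<Sum>y<n. (if {x, y} \<in> cycle_edges n then 1 else 0) * f y) =
      (\<Sum>y<n. (if y = Suc x mod n then f y else 0) + (if x = Suc y mod n then f y else 0))"
    by (rule sum.cong) (use assms disjoint in \<open>auto simp: cycle_edge_iff\<close>)
  then show ?thesis
    using n_ge_3 by (simp add: sum.distrib)
qed

text \<open>The index \<open>x + (n - 1)\<close> represents \<open>x - 1\<close> modulo
  \<open>n\<close> without truncated subtraction at \<open>x = 0\<close>.\<close>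

lemma sum_predecessor:
  fixes f :: "nat \<Rightarrow> real"
  assumes "x < n"
  shows "(\<Sum>y<n. if x = Suc y mod n then f y else 0) = f ((x + (n - 1)) mod n)"
proof -
  have "x = Suc y mod n \<longleftrightarrow> y = (x + (n - 1)) mod n" if "y < n" for y
  proof (cases x)
    case 0
    then show ?thesis
      using that n_ge_3 by (auto simp: mod_Suc)
  next
    case (Suc z)
    then have "x + (n - 1) = z + n"
      using n_ge_3 by simp
    then show ?thesis
      using that assms Suc by (auto simp: mod_Suc)
  qed
  then have "(\<Sum>y<n. if x = Suc y mod n then f y else 0) =
      (\<Sum>y<n. if y = (x + (n - 1)) mod n then f y else 0)"
    by (intro sum.cong) auto
  then show ?thesis
    using n_ge_3 by simp
qed

section \<open>The least eigenspace\<close>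

abbreviation A :: "real mat" where
  "A \<equiv> adjacency_matrix n (cycle_edges n)"

lemma A_carrier: "A \<in> carrier_mat n n"
  by (simp add: adjacency_matrix_def)

lemma A_mult_index:
  assumes "v \<in> carrier_vec n" "x < n"
  shows "(A *\<^sub>v v) $ x = (\<Sum>y<n. (if {x, y} \<in> cycle_edges n then 1 else 0) * v $ y)"
  using assms by (simp add: adjacency_matrix_def scalar_prod_def atLeast0LessThan)

text \<open>Each edge enters \<open>v \<bullet> (A *\<^sub>v v)\<close> once from either endpoint.
  Exchanging the sums moves the predecessor contributions onto the successor ones, which yields the
  factor 2 in \<open>cycle_form\<close>.\<close>

lemma cycle_form_eq_adjacency:
  assumes "v \<in> carrier_vec n"
  shows "cycle_form (\<lambda>x. v $ (x mod n)) = v \<bullet> (A *\<^sub>v v) - 2 * cos \<theta> * (v \<bullet> v)"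
proof -
  have "v \<bullet> (A *\<^sub>v v) = (\<Sum>x<n. v $ x * (A *\<^sub>v v) $ x)"
    using A_carrier by (simp add: scalar_prod_def atLeast0LessThan)
  also have "\<dots> = (\<Sum>x<n. v $ x * v $ (Suc x mod n)) +
      (\<Sum>x<n. \<Sum>y<n. if x = Suc y mod n then v $ x * v $ y else 0)"
    by (simp add: A_mult_index[OF assms] sum_cycle_neighbours distrib_left sum.distrib
        sum_distrib_left if_distrib[of "(*) _"] cong: if_cong)
  also have "(\<Sum>x<n. \<Sum>y<n. if x = Suc y mod n then v $ x * v $ y else 0) =
      (\<Sum>y<n. \<Sum>x<n. if x = Suc y mod n then v $ x * v $ y else 0)"
    by (rule sum.swap)
  also have "\<dots> = (\<Sum>y<n. v $ y * v $ (Suc y mod n))"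
    using n_ge_3 by (simp add: mult.commute)
  finally show ?thesis
    using assms
    by (simp add: cycle_form_def scalar_prod_def atLeast0LessThan sum_subtractf sum_distrib_left
        power2_eq_square mult.assoc sum.distrib flip: mult_2)
qed

definition wave :: "real \<Rightarrow> real \<Rightarrow> real vec" where
  "wave a b = vec n (\<lambda>x. a * cos (real x * \<theta>) + b * sin (real x * \<theta>))"

lemma wave_carrier: "wave a b \<in> carrier_vec n"
  by (simp add: wave_def)

text \<open>Periodicity replaces the two neighbours by the angles
  \<open>x * \<theta> + \<theta>\<close> and \<open>x * \<theta> - \<theta>\<close>, and the
  addition formulas give the factor \<open>2 * cos \<theta>\<close>.\<close>

lemma A_mult_wave: "A *\<^sub>v wave a b = (2 * cos \<theta>) \<cdot>\<^sub>v wave a b"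
proof (rule eq_vecI)
  fix x assume "x < dim_vec ((2 * cos \<theta>) \<cdot>\<^sub>v wave a b)"
  then have x: "x < n"
    by (simp add: wave_def)
  define f where "f y = a * cos (real y * \<theta>) + b * sin (real y * \<theta>)" for y
  have f_mod: "f (m mod n) = f m" for m
    by (simp add: f_def cos_mod sin_mod)
  have "(A *\<^sub>v wave a b) $ x = (\<Sum>y<n. (if {x, y} \<in> cycle_edges n then 1 else 0) * f y)"
    unfolding A_mult_index[OF wave_carrier x] by (rule sum.cong) (simp_all add: wave_def f_def)
  also have "\<dots> = f (Suc x) + f (x + (n - 1))"
    by (simp only: sum_cycle_neighbours[OF x] sum_predecessor[OF x] f_mod)
  also have "\<dots> = 2 * cos \<theta> * f x"
  proof -
    have "real (Suc x) * \<theta> = real x * \<theta> + \<theta>"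
      "real (x + (n - 1)) * \<theta> = (real x * \<theta> - \<theta>) + real n * \<theta>"
      using n_ge_3 by (simp_all add: algebra_simps of_nat_diff)
    then have "f (Suc x) = a * cos (real x * \<theta> + \<theta>) + b * sin (real x * \<theta> + \<theta>)"
      "f (x + (n - 1)) = a * cos (real x * \<theta> - \<theta>) + b * sin (real x * \<theta> - \<theta>)"
      unfolding f_def by (simp_all only: cos_add sin_add[of _ "real n * \<theta>"] cos_n_theta sin_n_theta) simp_all
    then show ?thesis
      by (simp add: f_def cos_add cos_diff sin_add sin_diff algebra_simps)
  qed
  finally show "(A *\<^sub>v wave a b) $ x = ((2 * cos \<theta>) \<cdot>\<^sub>v wave a b) $ x"
    using x by (simp add: wave_def f_def)
qed (use A_carrier in \<open>simp add: wave_def\<close>)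

text \<open>An eigenvector for \<open>2 * cos \<theta>\<close> annihilates the quadratic form, so
  the equality case of its nonnegativity forces it to be a wave.\<close>

lemma eigenspace_cycle: "eigenspace A (2 * cos \<theta>) = {wave a b | a b. True}"
proof
  show "{wave a b | a b. True} \<subseteq> eigenspace A (2 * cos \<theta>)"
  proof
    fix v assume "v \<in> {wave a b | a b. True}"
    then obtain a b where "v = wave a b"
      unfolding mem_Collect_eq by metis
    then show "v \<in> eigenspace A (2 * cos \<theta>)"
      using A_carrier by (simp add: eigenspace_def A_mult_wave wave_carrier)
  qed
  show "eigenspace A (2 * cos \<theta>) \<subseteq> {wave a b | a b. True}"
  proof
    fix v assume "v \<in> eigenspace A (2 * cos \<theta>)"
    then have v: "v \<in> carrier_vec n" "A *\<^sub>v v = (2 * cos \<theta>) \<cdot>\<^sub>v v"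
      using A_carrier by (simp_all add: eigenspace_def)
    then have "cycle_form (\<lambda>x. v $ (x mod n)) = 0"
      by (simp add: cycle_form_eq_adjacency)
    then obtain a b where "\<forall>x<n. v $ (x mod n) = a * cos (real x * \<theta>) + b * sin (real x * \<theta>)"
      using cycle_form_eq_0[of "\<lambda>x. v $ (x mod n)"] by auto
    then have "v = wave a b"
      using v(1) by (intro eq_vecI) (simp_all add: wave_def)
    then show "v \<in> {wave a b | a b. True}"
      unfolding mem_Collect_eq by metis
  qed
qed

text \<open>At an eigenvector \<open>v\<close> for \<open>\<mu>\<close> the form equals
  \<open>(\<mu> - 2 * cos \<theta>) * (v \<bullet> v)\<close>, so its nonnegativity bounds
  \<open>\<mu>\<close> from below.\<close>

lemma least_eigenvalue_cycle: "least_eigenvalue A (2 * cos \<theta>)"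
  unfolding least_eigenvalue_def
proof (intro conjI allI impI)
  have "wave 1 0 $ 0 = 1" "0 < n"
    using n_ge_3 by (simp_all add: wave_def)
  then have "wave 1 0 \<noteq> 0\<^sub>v n"
    by (metis index_zero_vec(1) zero_neq_one)
  then show "eigenvalue A (2 * cos \<theta>)"
    unfolding eigenvalue_def eigenvector_def
    using A_carrier A_mult_wave wave_carrier by (metis carrier_matD(1))
next
  fix \<mu> assume "eigenvalue A \<mu>"
  then obtain v where v: "v \<in> carrier_vec n" "v \<noteq> 0\<^sub>v n" "A *\<^sub>v v = \<mu> \<cdot>\<^sub>v v"
    unfolding eigenvalue_def eigenvector_def using A_carrier by (metis carrier_matD(1))
  have "0 \<le> cycle_form (\<lambda>x. v $ (x mod n))"
    by (rule cycle_form_nonneg) simp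
  also have "\<dots> = (\<mu> - 2 * cos \<theta>) * (v \<bullet> v)"
    unfolding cycle_form_eq_adjacency[OF v(1)] using v by (simp add: left_diff_distrib)
  finally have "0 \<le> (\<mu> - 2 * cos \<theta>) * (v \<bullet> v)" .
  moreover have "v \<bullet> v > 0"
  proof -
    obtain i where "i < n" "v $ i \<noteq> 0"
      using v(1,2) by (metis carrier_vecD eq_vecI index_zero_vec(1,2))
    then show ?thesis
      unfolding scalar_prod_def using v(1)
      by (intro sum_pos2[of _ i]) (auto simp: zero_less_mult_iff)
  qed
  ultimately show "2 * cos \<theta> \<le> \<mu>"
    by (simp add: zero_le_mult_iff)
qed

section \<open>The cosine-sine framework and its normalization\<close>

lemma odd_cycle_framework_eq:
  "odd_cycle_framework k x = vec_of_list [cos (real x * \<theta>), sin (real x * \<theta>)]"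
proof -
  have "2 * pi * real k * real x / real (2 * k + 1) = real x * \<theta>"
    unfolding \<theta>_def n_def[symmetric] by simp
  then show ?thesis
    by (simp only: odd_cycle_framework_def)
qed

lemma odd_cycle_framework_gram:
  "odd_cycle_framework k u \<bullet> odd_cycle_framework k v =
    cos (real u * \<theta>) * cos (real v * \<theta>) + sin (real u * \<theta>) * sin (real v * \<theta>)"
  by (simp add: odd_cycle_framework_eq scalar_prod_def vec_of_list_index numeral_2_eq_2)

text \<open>The cosine and sine vectors have squared norm \<open>n / 2\<close>; the factor
  \<open>sqrt (2 / n)\<close> normalizes them.\<close>

definition wave_basis :: "real mat" where
  "wave_basis = mat n 2 (\<lambda>(x, j). sqrt (2 / real n) *
     (if j = 0 then cos (real x * \<theta>) else sin (real x * \<theta>)))"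

lemma row_wave_basis:
  assumes "x < n"
  shows "row wave_basis x = sqrt (2 / real n) \<cdot>\<^sub>v odd_cycle_framework k x"
  using assms
  by (intro eq_vecI)
    (auto simp: wave_basis_def odd_cycle_framework_eq less_Suc_eq numeral_2_eq_2)

lemma orthonormal_basis_columns_wave_basis:
  "orthonormal_basis_columns n wave_basis (eigenspace A (2 * cos \<theta>))"
  unfolding orthonormal_basis_columns_iff
proof (intro conjI allI impI)
  show "wave_basis \<in> carrier_mat n (dim_col wave_basis)"
    by (simp add: wave_basis_def)
next
  fix i j assume "i < dim_col wave_basis" "j < dim_col wave_basis"
  then have ij: "i = 0 \<or> i = 1" "j = 0 \<or> j = 1"
    by (auto simp: wave_basis_def)
  define f where "f j x = (if j = (0::nat) then cos (real x * \<theta>) else sin (real x * \<theta>))" for j x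
  define r where "r = sqrt (2 / real n)"
  have "r * r = 2 / real n"
    by (simp add: r_def)
  then have rr: "(r * s) * (r * t) = (2 / real n) * (s * t)" for s t
    by (metis mult.assoc mult.left_commute)
  have entry: "col wave_basis j $ x = r * f j x" if "x < n" "j = 0 \<or> j = 1" for j x
    using that by (auto simp: wave_basis_def f_def r_def)
  have "col wave_basis i \<bullet> col wave_basis j = (\<Sum>x<n. (r * f i x) * (r * f j x))"
    unfolding scalar_prod_def
    by (rule sum.cong) (use entry ij in \<open>simp_all add: wave_basis_def atLeast0LessThan\<close>)
  also have "\<dots> = (\<Sum>x<n. (2 / real n) * (f i x * f j x))"
    by (simp only: rr)
  also have "\<dots> = (2 / real n) * (\<Sum>x<n. f i x * f j x)"
    by (simp only: sum_distrib_left)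
  also have "(\<Sum>x<n. f i x * f j x) = (if i = j then real n / 2 else 0)"
    using ij sum_cos_squared sum_sin_squared sum_cos_sin
    by (auto simp: f_def mult.commute)
  finally show "col wave_basis i \<bullet> col wave_basis j = (if i = j then 1 else 0)"
    using n_ge_3 by simp
next
  define r where "r = sqrt (2 / real n)"
  have "r \<noteq> 0"
    using n_ge_3 by (simp add: r_def)
  have mult: "wave_basis *\<^sub>v x = wave (r * x $ 0) (r * x $ 1)" if "x \<in> carrier_vec 2" for x
    using that
    by (intro eq_vecI)
      (auto simp: wave_basis_def wave_def r_def scalar_prod_def numeral_2_eq_2 algebra_simps)
  have onto: "\<exists>x. wave a b = wave_basis *\<^sub>v x \<and> x \<in> carrier_vec 2" for a b
  proof -
    define x where "x = vec 2 (\<lambda>i. if i = 0 then a / r else b / r)"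
    have x: "x \<in> carrier_vec 2"
      by (simp add: x_def)
    have "wave a b = wave_basis *\<^sub>v x"
      unfolding mult[OF x] using \<open>r \<noteq> 0\<close> by (simp add: x_def)
    then show ?thesis
      using x by metis
  qed
  have "dim_col wave_basis = 2"
    by (simp add: wave_basis_def)
  moreover have "(\<exists>x. w = wave_basis *\<^sub>v x \<and> x \<in> carrier_vec 2) \<longleftrightarrow> (\<exists>a b. w = wave a b)" for w
    using mult onto by metis
  ultimately show "{wave_basis *\<^sub>v x | x. x \<in> carrier_vec (dim_col wave_basis)} =
      eigenspace A (2 * cos \<theta>)"
    unfolding eigenspace_cycle by simp
qed

lemma least_eigenvalue_framework_odd_cycle:
  "least_eigenvalue_framework n (cycle_edges n)
    (\<lambda>x. sqrt (2 / real n) \<cdot>\<^sub>v odd_cycle_framework k x)"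
  unfolding least_eigenvalue_framework_def
  using least_eigenvalue_cycle orthonormal_basis_columns_wave_basis row_wave_basis by metis

text \<open>A least eigenvalue is unique, and the Gram matrix \<open>P * P\<^sup>T\<close> does not
  depend on the chosen basis, so it can be computed from \<open>wave_basis\<close>.\<close>

lemma least_eigenvalue_framework_gram:
  assumes "least_eigenvalue_framework n (cycle_edges n) p" "u < n" "v < n"
  shows "p u \<bullet> p v = 2 / real n *
    (cos (real u * \<theta>) * cos (real v * \<theta>) + sin (real u * \<theta>) * sin (real v * \<theta>))"
proof -
  obtain \<tau> P where P: "least_eigenvalue A \<tau>" "orthonormal_basis_columns n P (eigenspace A \<tau>)"
    "\<forall>v<n. p v = row P v"
    using assms(1) unfolding least_eigenvalue_framework_def by metis
  have "\<tau> = 2 * cos \<theta>"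
    using P(1) least_eigenvalue_cycle unfolding least_eigenvalue_def by (meson order_antisym)
  then have eq: "P * P\<^sup>T = wave_basis * wave_basis\<^sup>T"
    using P(2) orthonormal_basis_columns_wave_basis orthonormal_basis_columns_unique_projection
    by metis
  have dims: "dim_row P = n" "dim_row wave_basis = n"
    using P(2) orthonormal_basis_columns_wave_basis
    unfolding orthonormal_basis_columns_def by (metis carrier_matD(1))+
  have "p u \<bullet> p v = (P * P\<^sup>T) $$ (u, v)"
    using assms(2,3) P(3) dims by simp
  also have "\<dots> = row wave_basis u \<bullet> row wave_basis v"
    unfolding eq using assms(2,3) dims by simp
  also have "\<dots> = 2 / real n * (odd_cycle_framework k u \<bullet> odd_cycle_framework k v)"
  proof -
    have smult: "(r \<cdot>\<^sub>v a) \<bullet> (r \<cdot>\<^sub>v b) = (r * r) * (a \<bullet> b)"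
      if "a \<in> carrier_vec 2" "b \<in> carrier_vec 2" for r :: real and a b
      using that by simp
    show ?thesis
      unfolding row_wave_basis[OF assms(2)] row_wave_basis[OF assms(3)]
        smult[OF odd_cycle_framework_carrier odd_cycle_framework_carrier]
      by simp
  qed
  finally show ?thesis
    unfolding odd_cycle_framework_gram .
qed

section \<open>Universal completability\<close>

text \<open>The form takes nonnegative values on the coordinate functions of a dominated framework, and
  domination makes their sum nonpositive. Hence they all vanish and every strut inequality is
  tight. The Gram matrix of a wave framework is then determined by its entries at \<open>(0, 0)\<close>,
  \<open>(0, 1)\<close> and \<open>(1, 1)\<close>.\<close>

lemma universally_completable_of_gram:
  assumes T: "num_verts T = n" "edges T = cycle_edges n" "cables T = {}"
    and fw: "framework T p"
    and gram: "\<And>u v. u < n \<Longrightarrow> v < n \<Longrightarrow> p u \<bullet> p v = \<gamma> *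
      (cos (real u * \<theta>) * cos (real v * \<theta>) + sin (real u * \<theta>) * sin (real v * \<theta>))"
  shows "universally_completable T p"
  unfolding universally_completable_def
proof (intro conjI allI impI fw)
  fix q assume "framework T q" and dom: "dominates T p q"
  then obtain d where d: "\<And>v. v < n \<Longrightarrow> q v \<in> carrier_vec d"
    unfolding framework_def T by metis
  have q_prod: "q u \<bullet> q v = (\<Sum>i<d. q u $ i * q v $ i)" if "u < n" "v < n" for u v
    using d[OF that(2)] by (simp add: scalar_prod_def atLeast0LessThan)
  have q_norm: "q x \<bullet> q x = \<gamma>" if "x < n" for x
    using dom that gram[OF that that] unfolding dominates_def T by (simp flip: power2_eq_square)
  have q_edge: "q x \<bullet> q (Suc x mod n) \<le> \<gamma> * cos \<theta>" if "x < n" for x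
  proof -
    have s: "Suc x mod n < n"
      using that by simp
    \<comment> \<open>Without cables every edge is a bar or a strut, and both kinds bound the inner
      product in \<open>q\<close> from above.\<close>
    have "{x, Suc x mod n} \<in> bars T \<union> struts T"
      using T cycle_edge_iff[OF that s] by (auto simp: edges_def)
    then have "q x \<bullet> q (Suc x mod n) \<le> p x \<bullet> p (Suc x mod n)"
      using dom unfolding dominates_def by auto
    also have "\<dots> = \<gamma> * cos (real (Suc x) * \<theta> - real x * \<theta>)"
      unfolding gram[OF that s] cos_mod sin_mod cos_diff by (simp add: mult.commute)
    also have "real (Suc x) * \<theta> - real x * \<theta> = \<theta>"
      by (simp add: algebra_simps)
    finally show ?thesis .
  qed
  define y where "y i x = q (x mod n) $ i" for i x
  \<comment> \<open>Summing over the \<open>d\<close> coordinates turns products of entries into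
    inner products of \<open>q\<close>. The left side is nonnegative and the right side nonpositive,
    so both vanish.\<close>
  have form_sum: "(\<Sum>i<d. cycle_form (y i)) = - 2 * (\<Sum>x<n. \<gamma> * cos \<theta> - q x \<bullet> q (Suc x mod n))"
  proof -
    have "(\<Sum>i<d. cycle_form (y i)) =
        (\<Sum>x<n. \<Sum>i<d. 2 * y i x * y i (Suc x) - 2 * cos \<theta> * (y i x)\<^sup>2)"
      unfolding cycle_form_def by (rule sum.swap)
    also have "\<dots> = (\<Sum>x<n. 2 * (q x \<bullet> q (Suc x mod n)) - 2 * cos \<theta> * (q x \<bullet> q x))"
      by (rule sum.cong)
        (simp_all add: q_prod y_def sum_subtractf sum_distrib_left power2_eq_square mult.assoc)
    also have "\<dots> = (\<Sum>x<n. - 2 * (\<gamma> * cos \<theta> - q x \<bullet> q (Suc x mod n)))"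
      by (rule sum.cong) (simp_all add: q_norm)
    finally show ?thesis
      by (simp only: sum_distrib_left)
  qed
  have form_nonneg: "cycle_form (y i) \<ge> 0" for i
    by (rule cycle_form_nonneg) (simp add: y_def)
  have gap_nonneg: "(\<Sum>x<n. \<gamma> * cos \<theta> - q x \<bullet> q (Suc x mod n)) \<ge> 0"
    using q_edge by (intro sum_nonneg) simp
  have "(\<Sum>i<d. cycle_form (y i)) \<ge> 0"
    by (rule sum_nonneg) (rule form_nonneg)
  with form_sum gap_nonneg have form_0: "(\<Sum>i<d. cycle_form (y i)) = 0"
    and gap_0: "(\<Sum>x<n. \<gamma> * cos \<theta> - q x \<bullet> q (Suc x mod n)) = 0"
    by linarith+
  have "\<forall>x\<in>{..<n}. \<gamma> * cos \<theta> - q x \<bullet> q (Suc x mod n) = 0"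
    using gap_0 q_edge by (subst (asm) sum_nonneg_eq_0_iff) auto
  \<comment> \<open>The edge from 0 to 1 supplies the off-diagonal value that will force
    \<open>\<beta> = 0\<close>.\<close>
  then have q_01: "q 0 \<bullet> q 1 = \<gamma> * cos \<theta>"
    using n_ge_3 by (force dest: bspec[of _ _ 0])
  have "\<forall>i<d. cycle_form (y i) = 0"
    using form_0 form_nonneg by (subst (asm) sum_nonneg_eq_0_iff) auto
  then have "\<forall>i<d. \<exists>a b. \<forall>x<n. y i x = a * cos (real x * \<theta>) + b * sin (real x * \<theta>)"
    using cycle_form_eq_0[of "y i" for i] by (simp add: y_def[abs_def])
  then obtain a b where "\<forall>i<d. \<forall>x<n. y i x = a i * cos (real x * \<theta>) + b i * sin (real x * \<theta>)"
    by metis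
  then have ab: "q x $ i = a i * cos (real x * \<theta>) + b i * sin (real x * \<theta>)"
    if "i < d" "x < n" for i x
    using that by (simp add: y_def)
  \<comment> \<open>These are the inner products of the coefficient vectors \<open>a\<close> and
    \<open>b\<close>. They determine the Gram matrix of \<open>q\<close> whatever \<open>d\<close>
    is, and the goal is to show that they are \<open>\<gamma>\<close>, 0 and
    \<open>\<gamma>\<close>.\<close>
  define \<alpha> \<beta> \<delta> where "\<alpha> = (\<Sum>i<d. a i * a i)" and "\<beta> = (\<Sum>i<d. a i * b i)"
    and "\<delta> = (\<Sum>i<d. b i * b i)"
  have q_gram: "q u \<bullet> q v = cos (real u * \<theta>) * cos (real v * \<theta>) * \<alpha> +
      (cos (real u * \<theta>) * sin (real v * \<theta>) + sin (real u * \<theta>) * cos (real v * \<theta>)) * \<beta> +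
      sin (real u * \<theta>) * sin (real v * \<theta>) * \<delta>" if "u < n" "v < n" for u v
    unfolding q_prod[OF that] \<alpha>_def \<beta>_def \<delta>_def sum_distrib_left sum.distrib[symmetric]
    by (rule sum.cong) (use that in \<open>simp_all add: ab algebra_simps\<close>)
  have "\<alpha> = \<gamma>"
    using q_gram[of 0 0] q_norm[of 0] n_ge_3 by simp
  moreover have "\<beta> = 0"
    using q_gram[of 0 1] q_01 n_ge_3 sin_theta_nonzero \<open>\<alpha> = \<gamma>\<close> by simp
  moreover have "\<delta> = \<gamma>"
  proof -
    have "\<gamma> = cos \<theta> * cos \<theta> * \<gamma> + sin \<theta> * sin \<theta> * \<delta>"
      using q_gram[of 1 1] q_norm[of 1] n_ge_3 \<open>\<alpha> = \<gamma>\<close> \<open>\<beta> = 0\<close> by simp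
    moreover have "cos \<theta> * cos \<theta> = 1 - sin \<theta> * sin \<theta>"
      using sin_cos_squared_add3[of \<theta>] by linarith
    ultimately have "\<gamma> = (1 - sin \<theta> * sin \<theta>) * \<gamma> + sin \<theta> * sin \<theta> * \<delta>"
      by simp
    then have "sin \<theta> * sin \<theta> * (\<delta> - \<gamma>) = 0"
      unfolding left_diff_distrib right_diff_distrib mult_1_left by linarith
    then show ?thesis
      using sin_theta_nonzero by auto
  qed
  ultimately have "q u \<bullet> q v = p u \<bullet> p v" if "u < n" "v < n" for u v
    unfolding q_gram[OF that] gram[OF that] by (simp add: algebra_simps)
  then show "gram_matrix (num_verts T) q = gram_matrix (num_verts T) p"
    unfolding gram_matrix_def T by (intro eq_matI) simp_all
qed

end

theorem theorem3p6:
  fixes k n :: nat and T :: tensegrity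
  assumes "k \<ge> 1" and "n = 2 * k + 1"
    and "tensegrity_graph T"
    and "num_verts T = n"
    and "edges T = cycle_edges n"
    and "cables T = {}"
  shows "(\<exists>c > 0. least_eigenvalue_framework n (edges T) (\<lambda>x. c \<cdot>\<^sub>v odd_cycle_framework k x)) \<and>
    universally_completable T (odd_cycle_framework k) \<and>
    (\<forall>p. least_eigenvalue_framework n (edges T) p \<longrightarrow> universally_completable T p)"
proof -
  interpret odd_cycle k n
    by unfold_locales (use assms(1,2) in simp_all)
  note T = assms(4-6)
  have "framework T (odd_cycle_framework k)"
    unfolding framework_def using odd_cycle_framework_carrier by metis
  then have "universally_completable T (odd_cycle_framework k)"
    \<comment> \<open>Both kinds of framework have Gram entries
      \<open>\<gamma> * cos ((u - v) * \<theta>)\<close>: here the vectors have unit length, while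
      an orthonormal basis gives \<open>\<gamma> = 2 / n\<close>.\<close>
    by (rule universally_completable_of_gram[where \<gamma> = 1, OF T])
      (simp only: odd_cycle_framework_gram mult_1_left)
  moreover have "universally_completable T p" if p: "least_eigenvalue_framework n (edges T) p" for p
  proof (rule universally_completable_of_gram[OF T])
    obtain P where "\<forall>v<n. p v = row P v"
      using p unfolding least_eigenvalue_framework_def by metis
    then have "\<forall>v<num_verts T. p v \<in> carrier_vec (dim_col P)"
      using T(1) by simp
    then show "framework T p"
      unfolding framework_def by metis
    show "p u \<bullet> p v = 2 / real n *
        (cos (real u * \<theta>) * cos (real v * \<theta>) + sin (real u * \<theta>) * sin (real v * \<theta>))"
      if "u < n" "v < n" for u v
      using least_eigenvalue_framework_gram[OF _ that] p unfolding T(2) by metis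
  qed
  moreover have "sqrt (2 / real n) > 0"
    using n_ge_3 by simp
  ultimately show ?thesis
    using least_eigenvalue_framework_odd_cycle unfolding T(2) by metis
qed

end
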